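(* Let $\beta>0$, $\beta_3\in\mathbb{R}$ and $\lambda_0\in\mathbb{R}$, and suppose that either (i) $\beta_3>0$ and $\lambda_0>0$, or (ii) $\beta_3<0$ and $\lambda_0\in(0,-\beta/\beta_3)$. Then the real-valued solution $\lambda(t)$, $t\ge 0$, of the initial value problem $$\frac{d\lambda(t)}{dt}=-\beta\,\lambda(t)^2-\beta_3\,\lambda(t)^3\quad (t>0),\qquad \lambda(0)=\lambda_0,$$ satisfies $$\lim_{t\to\infty} t\,\lambda(t)=\frac{1}{\beta}.$$ *)

theory Defs
  imports Complex_Main
begin

end

theory Submission
  imports Defs
begin

text \<open>
  Put \<open>y = \<beta> + \<beta>\<^sub>3 x\<close>, so that \<open>x' = - x\<^sup>2 y\<close> and \<open>y' = - \<beta>\<^sub>3 x\<^sup>2 y\<close>. Both equations are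
  of the form \<open>u' = u h\<close> with \<open>h\<close> continuous, so \<open>x\<close> and \<open>y\<close> keep their positive initial signs.
  Hence \<open>x\<close> decreases and \<open>y\<close> is bounded below by some \<open>m > 0\<close>; since \<open>(1 / x)' = y\<close>, this gives
  \<open>1 / x \<ge> m t\<close>, so \<open>x \<longrightarrow> 0\<close> and \<open>y \<longrightarrow> \<beta>\<close>. L'Hopital's rule then yields \<open>(1 / x) / t \<longrightarrow> \<beta>\<close>.
\<close>

text \<open>On a compact interval \<open>h\<close> is bounded below, so the square of
  \<open>u\<close> times a suitable exponential cannot decrease. Hence \<open>u\<close> has no zero,
  and by the intermediate value theorem it cannot change sign.\<close>

lemma linear_ode_solution_pos:
  fixes u h :: "real \<Rightarrow> real"
  assumes cu: "continuous_on {0..} u" and ch: "continuous_on {0..} h"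
    and deriv: "\<And>t. t > 0 \<Longrightarrow> (u has_real_derivative u t * h t) (at t)"
    and u0: "u 0 > 0" and T: "T \<ge> 0"
  shows "u T > 0"
proof -
  have nonzero: "u s \<noteq> 0" if s: "s \<ge> 0" for s
  proof -
    have "continuous_on {0..s} h"
      using ch by (rule continuous_on_subset) auto
    then obtain r where r: "\<forall>t\<in>{0..s}. h r \<le> h t"
      using continuous_attains_inf[of "{0..s}" h] s by auto
    \<comment> \<open>The minimum of \<open>h\<close> on \<open>{0..s}\<close> is
      \<open>- K\<close>, so \<open>h t + K\<close> is nonnegative there.\<close>
    define K where "K = - h r"
    \<comment> \<open>Squaring makes the sign of the derivative independent of the sign of \<open>u\<close>.\<close>
    define w where "w = (\<lambda>t. (u t)\<^sup>2 * exp (2 * K * t))"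
    have "w 0 \<le> w s"
    proof (rule DERIV_nonneg_imp_increasing_open[OF s])
      fix t assume t: "0 < t" "t < s"
      have "(w has_real_derivative 2 * (u t)\<^sup>2 * (h t + K) * exp (2 * K * t)) (at t)"
        unfolding w_def using t
        by (auto intro!: derivative_eq_intros deriv simp: algebra_simps power2_eq_square)
      moreover have "h t + K \<ge> 0"
        using r t by (auto simp: K_def)
      ultimately show "\<exists>d. (w has_real_derivative d) (at t) \<and> 0 \<le> d"
        by (intro exI[of _ "2 * (u t)\<^sup>2 * (h t + K) * exp (2 * K * t)"]) auto
    next
      show "continuous_on {0..s} w"
        unfolding w_def
        by (intro continuous_intros continuous_on_subset[OF cu]) auto
    qed
    then show ?thesis
      using u0 by (auto simp: w_def)
  qed
  show ?thesis
  proof (rule ccontr)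
    assume "\<not> u T > 0"
    moreover have "continuous_on {0..T} u"
      using cu by (rule continuous_on_subset) auto
    ultimately obtain s where "0 \<le> s" "u s = 0"
      using IVT2'[of u T 0 0] u0 T by auto
    then show False
      using nonzero by blast
  qed
qed

theorem theorem3:
  fixes \<beta> \<beta>\<^sub>3 x\<^sub>0 :: real and x :: "real \<Rightarrow> real"
  assumes "\<beta> > 0"
    and "(\<beta>\<^sub>3 > 0 \<and> x\<^sub>0 > 0) \<or> (\<beta>\<^sub>3 < 0 \<and> x\<^sub>0 \<in> {0<..<- \<beta> / \<beta>\<^sub>3})"
    and "continuous_on {0..} x"
    and "\<And>t. t > 0 \<Longrightarrow> (x has_real_derivative (- \<beta> * (x t)^2 - \<beta>\<^sub>3 * (x t)^3)) (at t)"
    and "x 0 = x\<^sub>0"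
  shows "((\<lambda>t. t * x t) \<longlongrightarrow> 1 / \<beta>) at_top"
proof -
  define y where "y = (\<lambda>t. \<beta> + \<beta>\<^sub>3 * x t)"
  note cont = \<open>continuous_on {0..} x\<close>
  \<comment> \<open>For negative \<open>\<beta>\<^sub>3\<close>, the upper bound on
    \<open>x\<^sub>0\<close> says exactly that \<open>y 0 > 0\<close>.\<close>
  have x0: "x 0 > 0" and y0: "y 0 > 0"
    using assms(1,2,5) by (auto simp: y_def field_simps add_pos_pos)
  have dx: "(x has_real_derivative - (x t)\<^sup>2 * y t) (at t)" if "t > 0" for t
    using assms(4)[OF that] by (simp add: y_def algebra_simps power2_eq_square power3_eq_cube)
  have dy: "(y has_real_derivative y t * (- \<beta>\<^sub>3 * (x t)\<^sup>2)) (at t)" if "t > 0" for t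
    unfolding y_def
    by (rule derivative_eq_intros dx[OF that] refl)+ (simp add: y_def algebra_simps)
  have conty: "continuous_on {0..} y"
    unfolding y_def by (intro continuous_intros cont)
  have xpos: "x t > 0" if "t \<ge> 0" for t
    using that
  proof (rule linear_ode_solution_pos[of x "\<lambda>t. - x t * y t", rotated -1])
    show "(x has_real_derivative x t * (- x t * y t)) (at t)" if "t > 0" for t
      using dx[OF that] by (simp add: power2_eq_square mult.assoc)
  qed (intro continuous_intros cont conty x0)+
  have ypos: "y t > 0" if "t \<ge> 0" for t
    by (rule linear_ode_solution_pos[OF conty _ dy y0 that]) (intro continuous_intros cont)
  have xle: "x t \<le> x 0" if "t \<ge> 0" for t
  proof (rule DERIV_nonpos_imp_decreasing_open[OF that])
    show "\<exists>d. (x has_real_derivative d) (at s) \<and> d \<le> 0" if "0 < s" for s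
      using dx[OF that] ypos[of s] that by (intro exI conjI) (auto intro!: mult_nonneg_nonneg)
    show "continuous_on {0..t} x"
      using cont by (rule continuous_on_subset) auto
  qed
  \<comment> \<open>The two entries serve the two signs of \<open>\<beta>\<^sub>3\<close>: if it is
    nonnegative, \<open>x t > 0\<close> gives \<open>y t \<ge> \<beta>\<close>; if negative,
    \<open>x t \<le> x 0\<close> gives \<open>y t \<ge> y 0\<close>.\<close>
  define m where "m = min \<beta> (y 0)"
  have m: "m > 0"
    using assms(1) y0 by (simp add: m_def)
  have ym: "m \<le> y t" if "t \<ge> 0" for t
  proof (cases "\<beta>\<^sub>3 \<ge> 0")
    case True
    then show ?thesis
      using xpos[OF that] by (simp add: m_def y_def min.coboundedI1)
  next
    case False
    then show ?thesis
      using xle[OF that] by (simp add: m_def y_def min.coboundedI2 mult_left_mono_neg)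
  qed
  have dinv: "((\<lambda>t. 1 / x t) has_real_derivative y t) (at t)" if "t > 0" for t
    by (rule derivative_eq_intros dx[OF that] refl)+
      (use xpos[of t] that in \<open>auto simp: field_simps power2_eq_square\<close>)
  have xbound: "x t \<le> 1 / (m * t)" if t: "t > 0" for t
  proof -
    \<comment> \<open>The difference \<open>1 / x t - m * t\<close> has derivative
      \<open>y t - m\<close>, which is nonnegative.\<close>
    have "1 / x 0 - m * 0 \<le> 1 / x t - m * t"
    proof (rule DERIV_nonneg_imp_increasing_open[of 0 t])
      show "\<exists>d. ((\<lambda>t. 1 / x t - m * t) has_real_derivative d) (at s) \<and> 0 \<le> d" if "0 < s" for s
        using ym[of s] that
        by (intro exI[of _ "y s - m"]) (simp add: DERIV_diff[OF dinv DERIV_cmult_Id])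
      show "continuous_on {0..t} (\<lambda>t. 1 / x t - m * t)"
        using xpos by (intro continuous_intros continuous_on_subset[OF cont]) force+
    qed (use t in simp)
    moreover have "1 / x 0 > 0"
      using x0 by simp
    ultimately have "m * t \<le> 1 / x t"
      by linarith
    then show ?thesis
      using m t xpos[of t] by (simp add: field_simps)
  qed
  have x_lim: "(x \<longlongrightarrow> 0) at_top"
  proof (rule tendsto_sandwich)
    show "\<forall>\<^sub>F t in at_top. 0 \<le> x t"
      using eventually_ge_at_top[of 0] by eventually_elim (use xpos in force)
    show "\<forall>\<^sub>F t in at_top. x t \<le> 1 / (m * t)"
      using eventually_gt_at_top[of 0] by eventually_elim (rule xbound)
    show "((\<lambda>t. 1 / (m * t)) \<longlongrightarrow> 0) at_top"
      by (intro tendsto_divide_0[OF tendsto_const] filterlim_at_top_imp_at_infinity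
          filterlim_tendsto_pos_mult_at_top[OF tendsto_const m] filterlim_ident)
  qed simp
  have "(y \<longlongrightarrow> \<beta> + \<beta>\<^sub>3 * 0) at_top"
    unfolding y_def by (intro tendsto_intros x_lim)
  \<comment> \<open>In this form of the rule it is the denominator \<open>t\<close> that must tend
    to infinity; the quotient of the derivatives is \<open>y\<close>.\<close>
  then have "((\<lambda>t. (1 / x t) / t) \<longlongrightarrow> \<beta>) at_top"
    by (intro lhospital_at_top_at_top[where g = "\<lambda>t. t" and g' = "\<lambda>_. 1" and f' = y])
      (auto intro!: filterlim_ident eventually_mono[OF eventually_gt_at_top[of 0]] dinv)
  then have "((\<lambda>t. 1 / ((1 / x t) / t)) \<longlongrightarrow> 1 / \<beta>) at_top"
    using assms(1) by (intro tendsto_intros) auto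
  \<comment> \<open>Since division by zero yields 0, the reciprocal equals \<open>t * x t\<close>
    for every real \<open>t\<close>.\<close>
  then show ?thesis
    by (simp add: mult.commute)
qed

end
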